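(* Let $\mathcal F$ be a nontrivial (possibly infinite) union-closed family of sets such that $\dim \mathcal F \le 2$. Then $\mathcal F$ has an abundant element, i.e. there exists $x \in U_{\mathcal F}$ that is abundant in $\mathcal F$.
   Context: A family of sets $\mathcal F$ is a subset of some power set (it may be infinite). Its universe is $U_{\mathcal F} := \bigcup_{A \in \mathcal F} A$. The family is nontrivial if $\mathcal F$ is nonempty and $U_{\mathcal F} \neq \emptyset$, and union-closed if $A \cup B \in \mathcal F$ for all $A, B \in \mathcal F$. For $x \in U_{\mathcal F}$, $\mathcal F_x := \{A \in \mathcal F : x \in A\}$ and $\mathcal F_x^c := \mathcal F \setminus \mathcal F_x$. An element $x \in U_{\mathcal F}$ is abundant in $\mathcal F$ if there exists an injective map of sets $\mathcal F_x^c \hookrightarrow \mathcal F_x$. The length of a finite nonempty chain $C$ in a poset is $|C| - 1$, and the dimension of a poset is the supremum of the lengths of its chains; $\dim \mathcal F$ means the dimension of $(\mathcal F, \subseteq)$. *)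

theory Defs
  imports "HOL-Library.Extended_Nat" "HOL-Library.Equipollence"
begin

definition universe :: "'a set set \<Rightarrow> 'a set" where
  "universe F = \<Union>F"

definition nontrivial :: "'a set set \<Rightarrow> bool" where
  "nontrivial F \<longleftrightarrow> F \<noteq> {} \<and> universe F \<noteq> {}"

definition union_closed :: "'a set set \<Rightarrow> bool" where
  "union_closed F \<longleftrightarrow> (\<forall>A\<in>F. \<forall>B\<in>F. A \<union> B \<in> F)"

definition members_containing :: "'a set set \<Rightarrow> 'a \<Rightarrow> 'a set set" where
  "members_containing F x = {A \<in> F. x \<in> A}"

definition members_avoiding :: "'a set set \<Rightarrow> 'a \<Rightarrow> 'a set set" where
  "members_avoiding F x = F - members_containing F x"

(* Intended for x in the universe of F. By lepoll_def, the right-hand side says that an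
   injective map from members_avoiding F x into members_containing F x exists. *)
definition abundant :: "'a set set \<Rightarrow> 'a \<Rightarrow> bool" where
  "abundant F x \<longleftrightarrow> members_avoiding F x \<lesssim> members_containing F x"

definition finite_chains :: "'a::order set \<Rightarrow> 'a set set" where
  "finite_chains P = {C. C \<subseteq> P \<and> finite C \<and> C \<noteq> {} \<and> Complete_Partial_Order.chain (\<le>) C}"

definition chain_length :: "'a set \<Rightarrow> nat" where
  "chain_length C = card C - 1"

(* The supremum is taken in enat, so it is infinite when chain lengths are unbounded; the empty
   poset gets dimension 0. For a family of sets, the order on its members is inclusion. *)
definition poset_dim :: "'a::order set \<Rightarrow> enat" where
  "poset_dim P = (SUP C\<in>finite_chains P. enat (chain_length C))"

end

theory Submission
  imports Defs
begin

text \<open>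
  Four members never form a strictly increasing chain, so \<open>F\<close> has a maximal member, which by
  closure under union is its universe \<open>U\<close>. Call a maximal member of \<open>F - {U}\<close> a coatom. If \<open>x\<close> lies
  outside a coatom \<open>C\<close>, then for every member \<open>B\<close> avoiding \<open>x\<close> the member \<open>B \<union> C\<close> avoids \<open>x\<close> as well,
  hence equals \<open>C\<close>: the members avoiding \<open>x\<close> are exactly \<open>C\<close> and the members strictly below \<open>C\<close>
  (\<open>subset_coatom_if_avoiding\<close>). Moreover, two distinct members strictly below \<open>C\<close> have union \<open>C\<close>,
  since otherwise their union would be the second term of a chain of four
  (\<open>Un_eq_coatom\<close>).

  Suppose there are two coatoms \<open>C\<close> and \<open>D\<close>. At most one member lies strictly below both, because
  the union of two such members would be \<open>C\<close> and also \<open>D\<close>. Cardinals are comparable, so by symmetry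
  the members below \<open>C\<close> but not \<open>D\<close> inject into the members below \<open>D\<close> but not \<open>C\<close>. An element \<open>x\<close>
  outside \<open>C\<close> is then abundant: the latter members all contain \<open>x\<close>, and so do \<open>U\<close> and \<open>D\<close>, which make
  room for \<open>C\<close> and the possible common member (\<open>abundant_outside_coatom\<close>).

  If there is at most one coatom, some \<open>x\<close> in \<open>U\<close> is avoided by at most one member, and \<open>U\<close> is there
  to receive it (\<open>abundant_if_at_most_one_coatom\<close>). Cardinals enter only through their comparability, so finite
  and infinite families are treated alike.
\<close>

definition coatom :: "'a set set \<Rightarrow> 'a set \<Rightarrow> bool" where
  "coatom F C \<longleftrightarrow> C \<in> F \<and> C \<noteq> \<Union>F \<and> (\<forall>B\<in>F. C \<subset> B \<longrightarrow> B = \<Union>F)"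

definition below :: "'a set set \<Rightarrow> 'a set \<Rightarrow> 'a set set" where
  "below F C = {A \<in> F. A \<subset> C}"

lemma no_four_chain:
  assumes "poset_dim F \<le> 2" "A \<in> F" "B \<in> F" "C \<in> F" "D \<in> F"
  shows "\<not> (A \<subset> B \<and> B \<subset> C \<and> C \<subset> D)"
proof
  assume less: "A \<subset> B \<and> B \<subset> C \<and> C \<subset> D"
  have "{A, B, C, D} \<in> finite_chains F"
    using assms less by (auto simp: finite_chains_def chain_def)
  then have "enat (chain_length {A, B, C, D}) \<le> poset_dim F"
    unfolding poset_dim_def by (rule SUP_upper)
  moreover have "chain_length {A, B, C, D} = 3"
  proof -
    have "A \<noteq> B" "A \<noteq> C" "A \<noteq> D" "B \<noteq> C" "B \<noteq> D" "C \<noteq> D"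
      using less by auto
    then show ?thesis by (simp add: chain_length_def)
  qed
  ultimately have "enat 3 \<le> enat 2"
    using assms(1) by (metis numeral_eq_enat order_trans)
  then show False by simp
qed

text \<open>Comparability of cardinals, transferred from well-orders; it breaks the tie between two coatoms.\<close>

lemma lepoll_linear: "A \<lesssim> B \<or> B \<lesssim> A"
  unfolding lepoll_def card_of_ordLeq
  by (rule ordLeq_total[OF card_of_Well_order card_of_Well_order])

locale short_union_closed =
  fixes F :: "'a set set"
  assumes closed: "union_closed F"
    and dim: "poset_dim F \<le> 2"
    and nonempty: "F \<noteq> {}"
begin

lemma Un_mem: "A \<in> F \<Longrightarrow> B \<in> F \<Longrightarrow> A \<union> B \<in> F"
  using closed by (auto simp: union_closed_def)

text \<open>
  Climbing from any member stops after at most two steps, and a maximal member absorbs every other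
  member by closure under union.
\<close>

lemma top_mem: "\<Union>F \<in> F"
proof -
  have "\<exists>M\<in>F. \<forall>B\<in>F. \<not> M \<subset> B"
  proof (rule ccontr)
    assume "\<not> ?thesis"
    then have step: "\<exists>B\<in>F. A \<subset> B" if "A \<in> F" for A using that by blast
    obtain A where "A \<in> F" using nonempty by blast
    moreover obtain B where "B \<in> F" "A \<subset> B" using step calculation by blast
    moreover obtain C where "C \<in> F" "B \<subset> C" using step calculation by blast
    moreover obtain D where "D \<in> F" "C \<subset> D" using step calculation by blast
    ultimately show False using no_four_chain[OF dim] by blast
  qed
  then obtain M where M: "M \<in> F" "\<And>B. B \<in> F \<Longrightarrow> \<not> M \<subset> B" by blast
  have "B \<subseteq> M" if "B \<in> F" for B
    using M(2)[OF Un_mem[OF M(1) that]] by blast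
  then have "\<Union>F = M" using M(1) by blast
  then show ?thesis using M(1) by simp
qed

lemma subset_coatom:
  assumes "A \<in> F" "A \<noteq> \<Union>F"
  obtains C where "coatom F C" "A \<subseteq> C"
proof (cases "coatom F A")
  case False
  then obtain B where B: "B \<in> F" "A \<subset> B" "B \<noteq> \<Union>F"
    using assms by (auto simp: coatom_def)
  have "E = \<Union>F" if "E \<in> F" "B \<subset> E" for E
  proof (rule ccontr)
    assume "E \<noteq> \<Union>F"
    then have "E \<subset> \<Union>F" using that by blast
    then show False using no_four_chain[OF dim assms(1) B(1) that(1) top_mem] B(2) that(2) by blast
  qed
  then have "coatom F B" using B by (auto simp: coatom_def)
  then show thesis using that B by blast
qed (use that in blast)

text \<open>
  Adjoining \<open>C\<close> to \<open>B\<close> cannot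
  reach \<open>\<Union>F\<close>, since \<open>x\<close> is still missing. It determines the members avoiding \<open>x\<close> completely.
\<close>

lemma subset_coatom_if_avoiding:
  assumes "coatom F C" "x \<in> \<Union>F - C" "B \<in> F" "x \<notin> B"
  shows "B \<subseteq> C"
proof -
  have "B \<union> C \<in> F" using assms by (simp add: coatom_def Un_mem)
  moreover have "B \<union> C \<noteq> \<Union>F" using assms by blast
  ultimately have "\<not> C \<subset> B \<union> C" using assms(1) by (auto simp: coatom_def)
  then show ?thesis by blast
qed

text \<open>
  Members strictly below a coatom sit two levels under \<open>\<Union>F\<close>, so there is no room for their union to
  lie strictly between them and \<open>C\<close>.
\<close>

lemma Un_eq_coatom:
  assumes C: "coatom F C" and A: "A \<in> below F C" and B: "B \<in> below F C" and "A \<noteq> B"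
  shows "A \<union> B = C"
proof (rule ccontr)
  assume ne: "A \<union> B \<noteq> C"
  have mem: "A \<in> F" "B \<in> F" "C \<in> F" "A \<subset> C" "B \<subset> C"
    using assms by (auto simp: below_def coatom_def)
  have C_top: "C \<subset> \<Union>F" using C by (auto simp: coatom_def)
  have AB: "A \<union> B \<in> F" "A \<union> B \<subset> C" using mem Un_mem ne by auto
  \<comment> \<open>The union strictly contains one of the two, even if they are comparable.\<close>
  have "A \<subset> A \<union> B \<or> B \<subset> A \<union> B" using \<open>A \<noteq> B\<close> by blast
  then show False
    using no_four_chain[OF dim mem(1) AB(1) mem(3) top_mem]
      no_four_chain[OF dim mem(2) AB(1) mem(3) top_mem] AB(2) C_top by blast
qed

lemma coatom_not_psubset: "coatom F C \<Longrightarrow> coatom F D \<Longrightarrow> \<not> C \<subset> D"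
  by (auto simp: coatom_def)

lemma common_below_unique:
  assumes "coatom F C" "coatom F D" "C \<noteq> D"
    and "A \<in> below F C \<inter> below F D" "B \<in> below F C \<inter> below F D"
  shows "A = B"
  using assms Un_eq_coatom[of C A B] Un_eq_coatom[of D A B] by blast

text \<open>
  The members avoiding \<open>x\<close> are \<open>C\<close>, at most one member below both coatoms, and those below \<open>C\<close> only.
  The first two kinds go to \<open>\<Union>F\<close> and \<open>D\<close>; the last kind goes to the members below \<open>D\<close> only,
  which contain \<open>x\<close> because they are not included in \<open>C\<close>.
\<close>

lemma abundant_outside_coatom:
  assumes C: "coatom F C" and D: "coatom F D" and "C \<noteq> D"
    and le: "below F C - below F D \<lesssim> below F D - below F C"
    and x: "x \<in> \<Union>F - C"
  shows "abundant F x"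
proof -
  have CD: "C \<in> F" "D \<in> F" "C \<noteq> \<Union>F" "D \<noteq> \<Union>F" using C D by (auto simp: coatom_def)
  have contains: "x \<in> B" if "B \<in> F" "B \<notin> below F C" "B \<noteq> C" for B
    using subset_coatom_if_avoiding[OF C x that(1)] that by (auto simp: below_def)
  have "D \<notin> below F C" using coatom_not_psubset[OF D C] by (simp add: below_def)
  moreover have "C \<notin> below F D" using coatom_not_psubset[OF C D] by (simp add: below_def)
  ultimately have "insert (\<Union>F) (insert D (below F D - below F C)) \<subseteq> members_containing F x"
    using CD contains x top_mem \<open>C \<noteq> D\<close> by (auto simp: members_containing_def below_def)
  then have target: "{\<Union>F, D} \<union> (below F D - below F C) \<subseteq> members_containing F x"
    by simp
  obtain a where "below F C \<inter> below F D \<subseteq> {a}"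
    using common_below_unique[OF C D \<open>C \<noteq> D\<close>] by blast
  then have source: "members_avoiding F x \<subseteq> {C, a} \<union> (below F C - below F D)"
    using contains by (auto simp: members_avoiding_def members_containing_def)
  have "{C, a} \<lesssim> {\<Union>F, D}"
    using CD(4) by (intro lepoll_iff_card_le[THEN iffD2]) (auto simp: card_insert_if)
  moreover have "disjnt {\<Union>F, D} (below F D - below F C)"
    using CD(2) by (auto simp: disjnt_def below_def)
  ultimately have "{C, a} \<union> (below F C - below F D) \<lesssim> {\<Union>F, D} \<union> (below F D - below F C)"
    using le by (intro Un_lepoll_mono)
  then show ?thesis unfolding abundant_def
    by (meson lepoll_trans subset_imp_lepoll source target)
qed

text \<open>
  Every member except \<open>\<Union>F\<close> is included in the single coatom, if there is one. For \<open>x\<close> in that coatom,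
  two distinct members avoiding \<open>x\<close> would have the coatom as their union, although it contains \<open>x\<close>.
  If no coatom has an element, the only member besides \<open>\<Union>F\<close> can be the empty set. So in either
  case at most one member avoids \<open>x\<close>.
\<close>

lemma abundant_if_at_most_one_coatom:
  assumes unique: "\<And>C D. coatom F C \<Longrightarrow> coatom F D \<Longrightarrow> C = D" and "\<Union>F \<noteq> {}"
  shows "\<exists>x\<in>\<Union>F. abundant F x"
proof -
  have "\<exists>x\<in>\<Union>F. \<forall>A\<in>F. \<forall>B\<in>F. x \<notin> A \<longrightarrow> x \<notin> B \<longrightarrow> A = B"
  proof (cases "\<exists>C x. coatom F C \<and> x \<in> C")
    case True
    then obtain C x where C: "coatom F C" "x \<in> C" by blast
    have "A \<in> below F C" if "A \<in> F" "x \<notin> A" for A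
    proof -
      have "C \<in> F" using C by (simp add: coatom_def)
      then have "A \<noteq> \<Union>F" using that C by blast
      then have "A \<subseteq> C" using subset_coatom[OF that(1)] unique C by blast
      then show ?thesis using that C by (auto simp: below_def)
    qed
    moreover have "x \<in> \<Union>F" using C by (auto simp: coatom_def)
    ultimately show ?thesis using Un_eq_coatom[OF C(1)] C(2) by blast
  next
    case False
    obtain x where "x \<in> \<Union>F" using assms(2) by blast
    moreover have "A = {}" if A: "A \<in> F" "x \<notin> A" for A
    proof -
      have "A \<noteq> \<Union>F" using A calculation by blast
      then obtain C where "coatom F C" "A \<subseteq> C" using subset_coatom[OF A(1)] by blast
      then show ?thesis using False by blast
    qed
    ultimately show ?thesis by blast
  qed
  then obtain x where x: "x \<in> \<Union>F" "\<And>A B. A \<in> F \<Longrightarrow> B \<in> F \<Longrightarrow> x \<notin> A \<Longrightarrow> x \<notin> B \<Longrightarrow> A = B"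
    by blast
  obtain a where "members_avoiding F x \<subseteq> {a}"
    using x(2) unfolding members_avoiding_def members_containing_def by blast
  moreover have "{\<Union>F} \<subseteq> members_containing F x"
    using x(1) top_mem by (auto simp: members_containing_def)
  moreover have "{a} \<lesssim> {\<Union>F}" by (simp add: lepoll_iff_card_le)
  ultimately have "abundant F x" unfolding abundant_def
    by (meson lepoll_trans subset_imp_lepoll)
  then show ?thesis using x(1) by blast
qed

end

theorem mainTheorem2:
  fixes F :: "'a set set"
  assumes "nontrivial F"
    and "union_closed F"
    and "poset_dim F \<le> 2"
  shows "\<exists>x\<in>universe F. abundant F x"
proof -
  interpret short_union_closed F
    using assms by unfold_locales (auto simp: nontrivial_def)
  have outside: "\<exists>x. x \<in> \<Union>F - C" if "coatom F C" for C
    using that by (auto simp: coatom_def)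
  show ?thesis
  proof (cases "\<exists>C D. coatom F C \<and> coatom F D \<and> C \<noteq> D")
    case True
    then obtain C D where CD: "coatom F C" "coatom F D" "C \<noteq> D" by blast
    obtain x y where "x \<in> \<Union>F - C" "y \<in> \<Union>F - D"
      using outside[OF CD(1)] outside[OF CD(2)] by blast
    then have "abundant F x \<or> abundant F y"
      using lepoll_linear[of "below F C - below F D" "below F D - below F C"]
        abundant_outside_coatom[OF CD, of x]
        abundant_outside_coatom[OF CD(2,1) CD(3)[symmetric], of y] by argo
    then show ?thesis
      using \<open>x \<in> \<Union>F - C\<close> \<open>y \<in> \<Union>F - D\<close> by (auto simp: universe_def)
  next
    case False
    then have "\<And>C D. coatom F C \<Longrightarrow> coatom F D \<Longrightarrow> C = D" by blast
    moreover have "\<Union>F \<noteq> {}" using assms(1) by (simp add: nontrivial_def universe_def)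
    ultimately have "\<exists>x\<in>\<Union>F. abundant F x" by (rule abundant_if_at_most_one_coatom)
    then show ?thesis by (simp only: universe_def)
  qed
qed

end
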